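(* Let $n\ge 1$, $\mathcal I=\{1,\dots,n\}$, and let $W=(w_{ij})\in\mathbb R^{n\times n}$ have entries in $[0,1]$, zero diagonal and row sums equal to $1$. Let $a_i,b_i,p_i,\gamma_i$ ($i\in\mathcal I$) be real numbers with $\gamma_i\ge 0$, $a_i>p_i$ and $b_i>\gamma_i$ for all $i\in\mathcal I$. Consider the game in which each user $i$ chooses $x_i\ge 0$ and has payoff $$u_i(x_i,\mathbf x_{-i})=a_ix_i-b_ix_i^2-p_ix_i+\gamma_ix_i\Big(\sum_{j\in\mathcal I}w_{ij}x_j-x_i\Big).$$ Then, given the price vector $\mathbf p=(p_1,\dots,p_n)$ and the consumptions $\mathbf x_{-i}\ge \mathbf 0$ of the other users, the utility-maximizing response of user $i$ over $x_i\ge 0$ is $$x_i^\ast=\frac{a_i-p_i+\gamma_i\sum_{j\in\mathcal I}w_{ij}x_j}{2(b_i+\gamma_i)}.$$ Further, the consumptions $\{x_1^\ast,\dots,x_n^\ast\}$ that simultaneously satisfy these best-response equations for all $i\in\mathcal I$ constitute a unique Nash equilibrium of this game.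
   Context: $w_{ij}$ is the strength of influence of user $j$ on user $i$; $x_i$ is the electricity consumption of user $i$ and $p_i$ the unit price she pays. $\mathbf x_{-i}$ denotes the consumptions of all users other than $i$. Since $w_{ii}=0$, the right-hand side of the best-response formula depends only on $\mathbf x_{-i}$. This game is the second stage of a two-stage game in which a utility company first sets the prices. *)

theory Defs
  imports "HOL-Analysis.Analysis"
begin

definition payoff ::
    "real^'n^'n \<Rightarrow> real^'n \<Rightarrow> real^'n \<Rightarrow> real^'n \<Rightarrow> real^'n \<Rightarrow> 'n \<Rightarrow> real^'n \<Rightarrow> real" where
  "payoff W a b p \<gamma> i x =
     a $ i * x $ i - b $ i * (x $ i)\<^sup>2 - p $ i * x $ i
       + \<gamma> $ i * x $ i * ((\<Sum>j\<in>UNIV. W $ i $ j * x $ j) - x $ i)"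

definition deviate :: "real^'n \<Rightarrow> 'n \<Rightarrow> real \<Rightarrow> real^'n" where
  "deviate x i y = (\<chi> j. if j = i then y else x $ j)"

text \<open>A utility profile \<open>u\<close> has one utility function per player; every strategy set is the set
  of nonnegative reals. Only the components of \<open>x\<close> other than \<open>x $ i\<close> matter in
  \<open>is_best_response u i x y\<close>.\<close>

definition is_best_response :: "('n \<Rightarrow> real^'n \<Rightarrow> real) \<Rightarrow> 'n \<Rightarrow> real^'n \<Rightarrow> real \<Rightarrow> bool" where
  "is_best_response u i x y \<longleftrightarrow> is_arg_max (\<lambda>z. u i (deviate x i z)) (\<lambda>z. 0 \<le> z) y"

definition nash_equilibrium :: "('n \<Rightarrow> real^'n \<Rightarrow> real) \<Rightarrow> real^'n \<Rightarrow> bool" where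
  "nash_equilibrium u x \<longleftrightarrow>
     (\<forall>i. 0 \<le> x $ i \<and> (\<forall>y\<ge>0. u i (deviate x i y) \<le> u i x))"

definition response_formula ::
    "real^'n^'n \<Rightarrow> real^'n \<Rightarrow> real^'n \<Rightarrow> real^'n \<Rightarrow> real^'n \<Rightarrow> 'n \<Rightarrow> real^'n \<Rightarrow> real" where
  "response_formula W a b p \<gamma> i x =
     (a $ i - p $ i + \<gamma> $ i * (\<Sum>j\<in>UNIV. W $ i $ j * x $ j)) / (2 * (b $ i + \<gamma> $ i))"

end

theory Submission
  imports Defs
begin

text \<open>Since \<open>W $ i $ i = 0\<close>, the payoff of user \<open>i\<close> is a concave parabola in her own consumption
  whose vertex is the response formula. The best-response equations read
  \<open>x = c + D W x\<close> with \<open>c > 0\<close> and \<open>D\<close> diagonal with entries in \<open>[0, 1)\<close>. Looking at a smallest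
  component shows that every solution with \<open>c \<ge> 0\<close> is nonnegative. Applied to \<open>x\<close> and \<open>-x\<close> for
  \<open>c = 0\<close> this makes \<open>I - D W\<close> injective, hence bijective, so the equations have exactly one
  solution; being nonnegative, it is the only equilibrium.\<close>

text \<open>At an index \<open>i\<close> where \<open>x\<close> is smallest, the weighted mean over
  row \<open>i\<close> is at least \<open>x $ i\<close>. The equation then gives
  \<open>(1 - d $ i) * x $ i \<ge> c $ i\<close>, and \<open>d $ i < 1\<close> settles the
  sign.\<close>

lemma weighted_mean_fixpoint_nonneg:
  fixes W :: "real^'n^'n" and c d x :: "real^'n"
  assumes W: "\<And>i j. 0 \<le> W $ i $ j" "\<And>i. (\<Sum>j\<in>UNIV. W $ i $ j) = 1"
    and d: "\<And>i. 0 \<le> d $ i" "\<And>i. d $ i < 1"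
    and c: "\<And>i. 0 \<le> c $ i"
    and x: "\<And>i. x $ i = c $ i + d $ i * (\<Sum>j\<in>UNIV. W $ i $ j * x $ j)"
  shows "0 \<le> x $ k"
proof -
  have "finite (range (($) x))" by simp
  then have "Min (range (($) x)) \<in> range (($) x)" by (intro Min_in) auto
  then obtain i where i: "x $ i = Min (range (($) x))" by (metis imageE)
  have min: "x $ i \<le> x $ j" for j unfolding i by simp
  have "x $ i = (\<Sum>j\<in>UNIV. W $ i $ j * x $ i)"
    by (simp add: W(2) flip: sum_distrib_right)
  also have "\<dots> \<le> (\<Sum>j\<in>UNIV. W $ i $ j * x $ j)"
    by (intro sum_mono mult_left_mono min W)
  finally have "d $ i * x $ i \<le> d $ i * (\<Sum>j\<in>UNIV. W $ i $ j * x $ j)"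
    by (intro mult_left_mono d)
  with x[of i] c[of i] have "0 \<le> (1 - d $ i) * x $ i" by (simp add: algebra_simps)
  with d(2)[of i] have "0 \<le> x $ i" by (simp add: zero_le_mult_iff)
  with min[of k] show ?thesis by linarith
qed

text \<open>The equations say \<open>f x = c\<close> for a linear endomorphism \<open>f\<close> of a
  finite-dimensional space, so a trivial kernel yields existence as well as uniqueness.\<close>

lemma weighted_mean_fixpoint_unique:
  fixes W :: "real^'n^'n" and c d :: "real^'n"
  assumes W: "\<And>i j. 0 \<le> W $ i $ j" "\<And>i. (\<Sum>j\<in>UNIV. W $ i $ j) = 1"
    and d: "\<And>i. 0 \<le> d $ i" "\<And>i. d $ i < 1"
  shows "\<exists>!x :: real^'n. \<forall>i. x $ i = c $ i + d $ i * (\<Sum>j\<in>UNIV. W $ i $ j * x $ j)"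
proof -
  define f :: "real^'n \<Rightarrow> real^'n"
    where "f x = (\<chi> i. x $ i - d $ i * (\<Sum>j\<in>UNIV. W $ i $ j * x $ j))" for x
  have lin: "linear f"
  proof (rule linearI)
    show "f (x + y) = f x + f y" for x y
      by (simp add: f_def vec_eq_iff distrib_left sum.distrib)
    have "(\<Sum>j\<in>UNIV. W $ i $ j * (r * x $ j)) = r * (\<Sum>j\<in>UNIV. W $ i $ j * x $ j)" for i r x
      by (simp add: sum_distrib_left mult.left_commute)
    then show "f (r *\<^sub>R x) = r *\<^sub>R f x" for r x
      by (simp add: f_def vec_eq_iff right_diff_distrib mult.left_commute)
  qed
  have "x = 0" if "f x = 0" for x
  proof -
    have x: "x $ i = d $ i * (\<Sum>j\<in>UNIV. W $ i $ j * x $ j)" for i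
    proof -
      have "f x $ i = 0" using that by simp
      then show ?thesis unfolding f_def by simp
    qed
    have "0 \<le> x $ k" for k
      by (rule weighted_mean_fixpoint_nonneg[OF W d, where c = 0]) (simp_all flip: x)
    \<comment> \<open>The homogeneous equations are invariant under negation.\<close>
    moreover have "0 \<le> (- x) $ k" for k
      by (rule weighted_mean_fixpoint_nonneg[OF W d, where c = 0])
        (simp_all add: sum_negf flip: x)
    ultimately show ?thesis by (simp add: vec_eq_iff order_antisym)
  qed
  then have "inj f" using linear_injective_0[OF lin] by blast
  then have "bij f" using linear_injective_imp_surjective[OF lin] by (simp add: bij_def)
  then have "\<exists>!x. f x = c" by (metis bij_pointE)
  moreover have "f x = c \<longleftrightarrow> (\<forall>i. x $ i = c $ i + d $ i * (\<Sum>j\<in>UNIV. W $ i $ j * x $ j))" for x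
    by (simp add: f_def vec_eq_iff diff_eq_eq)
  ultimately show ?thesis by simp
qed

text \<open>Completing the square: only \<open>(y - r)\<^sup>2\<close> depends on \<open>y\<close>,
  so comparing payoffs means comparing distances to the vertex \<open>r\<close>.\<close>

lemma payoff_deviate_eq:
  fixes W :: "real^'n^'n" and a b p \<gamma> x :: "real^'n"
  assumes "W $ i $ i = 0" and "b $ i + \<gamma> $ i \<noteq> 0"
  defines "r \<equiv> response_formula W a b p \<gamma> i x"
  shows "payoff W a b p \<gamma> i (deviate x i y) = (b $ i + \<gamma> $ i) * (r\<^sup>2 - (y - r)\<^sup>2)"
proof -
  define S where "S = (\<Sum>j\<in>UNIV. W $ i $ j * x $ j)"
  \<comment> \<open>The only component that the deviation changes carries weight zero.\<close>
  have S: "(\<Sum>j\<in>UNIV. W $ i $ j * deviate x i y $ j) = S"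
    unfolding S_def by (rule sum.cong) (auto simp: deviate_def assms(1))
  have "2 * (b $ i + \<gamma> $ i) * r = a $ i - p $ i + \<gamma> $ i * S"
    using assms(2) by (simp add: r_def response_formula_def S_def)
  \<comment> \<open>This product is the cross term of the expanded square; with it the goal is
    linear in the monomials.\<close>
  then have "(2 * (b $ i + \<gamma> $ i) * r) * y = (a $ i - p $ i + \<gamma> $ i * S) * y" by simp
  then show ?thesis
    unfolding payoff_def S by (simp add: deviate_def power2_eq_square algebra_simps)
qed

text \<open>Hypothesis \<open>r\<close> makes the vertex of the parabola feasible, and strict
  concavity makes it the only maximizer.\<close>

lemma is_best_response_payoff_iff:
  fixes W :: "real^'n^'n" and a b p \<gamma> x :: "real^'n"
  assumes "W $ i $ i = 0" and pos: "0 < b $ i + \<gamma> $ i"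
    and r: "0 \<le> response_formula W a b p \<gamma> i x"
  shows "is_best_response (payoff W a b p \<gamma>) i x y \<longleftrightarrow> y = response_formula W a b p \<gamma> i x"
proof -
  let ?r = "response_formula W a b p \<gamma> i x"
  have *: "payoff W a b p \<gamma> i (deviate x i y) < payoff W a b p \<gamma> i (deviate x i z)
      \<longleftrightarrow> (z - ?r)\<^sup>2 < (y - ?r)\<^sup>2" for z
    using pos by (subst (1 2) payoff_deviate_eq) (auto simp: assms(1))
  show ?thesis
    unfolding is_best_response_def is_arg_max_def *
  proof safe
    assume "\<nexists>z. 0 \<le> z \<and> (z - ?r)\<^sup>2 < (y - ?r)\<^sup>2"
    with r have "\<not> (?r - ?r)\<^sup>2 < (y - ?r)\<^sup>2" by blast
    then show "y = ?r" by simp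
  qed (use r in auto)
qed

lemma nash_equilibrium_iff_best_response:
  "nash_equilibrium u x \<longleftrightarrow> (\<forall>i. is_best_response u i x (x $ i))"
proof -
  have "deviate x i (x $ i) = x" for i by (simp add: deviate_def vec_eq_iff)
  then show ?thesis
    by (auto simp: nash_equilibrium_def is_best_response_def is_arg_max_def not_less)
qed

theorem theorem1:
  fixes W :: "real^'n^'n" and a b p \<gamma> :: "real^'n"
  assumes "\<And>i j. 0 \<le> W $ i $ j" and "\<And>i j. W $ i $ j \<le> 1"
    and "\<And>i. W $ i $ i = 0"
    and "\<And>i. (\<Sum>j\<in>UNIV. W $ i $ j) = 1"
    and "\<And>i. 0 \<le> \<gamma> $ i"
    and "\<And>i. p $ i < a $ i"
    and "\<And>i. \<gamma> $ i < b $ i"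
  shows "(\<forall>i x. (\<forall>j. j \<noteq> i \<longrightarrow> 0 \<le> x $ j) \<longrightarrow>
            (\<forall>y. is_best_response (payoff W a b p \<gamma>) i x y
                   \<longleftrightarrow> y = response_formula W a b p \<gamma> i x))
       \<and> (\<exists>!x. \<forall>i. x $ i = response_formula W a b p \<gamma> i x)
       \<and> (\<forall>x. (\<forall>i. x $ i = response_formula W a b p \<gamma> i x)
              \<longrightarrow> nash_equilibrium (payoff W a b p \<gamma>) x)
       \<and> (\<exists>!x. nash_equilibrium (payoff W a b p \<gamma>) x)"
proof -
  let ?R = "response_formula W a b p \<gamma>"
  let ?u = "payoff W a b p \<gamma>"
  have pos: "0 < b $ i + \<gamma> $ i" for i using assms(5,7)[of i] by linarith
  have resp_nonneg: "0 \<le> ?R i x" if "\<forall>j. j \<noteq> i \<longrightarrow> 0 \<le> x $ j" for i x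
  proof -
    \<comment> \<open>The sign of \<open>x $ i\<close> is unknown here, but its weight is
      zero.\<close>
    have "0 \<le> W $ i $ j * x $ j" for j
      using that assms(1,3) by (cases "j = i") auto
    then have "0 \<le> \<gamma> $ i * (\<Sum>j\<in>UNIV. W $ i $ j * x $ j)"
      by (intro mult_nonneg_nonneg[OF assms(5)] sum_nonneg)
    then show ?thesis
      using assms(6)[of i] pos[of i] unfolding response_formula_def
      by (intro divide_nonneg_pos) auto
  qed
  have best: "is_best_response ?u i x y \<longleftrightarrow> y = ?R i x"
    if "\<forall>j. j \<noteq> i \<longrightarrow> 0 \<le> x $ j" for i x y
    by (rule is_best_response_payoff_iff[OF assms(3) pos resp_nonneg[OF that]])

  define c d :: "real^'n"
    where "c = (\<chi> i. (a $ i - p $ i) / (2 * (b $ i + \<gamma> $ i)))"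
      and "d = (\<chi> i. \<gamma> $ i / (2 * (b $ i + \<gamma> $ i)))"
  have R: "?R i x = c $ i + d $ i * (\<Sum>j\<in>UNIV. W $ i $ j * x $ j)" for i x
    by (simp add: response_formula_def c_def d_def add_divide_distrib)
  have c: "0 \<le> c $ i" for i using assms(6)[of i] pos[of i] by (simp add: c_def)
  have d: "0 \<le> d $ i" "d $ i < 1" for i
    using assms(5,7)[of i] pos[of i] by (simp_all add: d_def)
  have ex1: "\<exists>!x. \<forall>i. x $ i = ?R i x"
    unfolding R by (rule weighted_mean_fixpoint_unique[OF assms(1,4) d])
  \<comment> \<open>\<open>ex1\<close> ranges over all real vectors; nonnegativity makes its
    solution a feasible profile, to which \<open>best\<close> applies.\<close>
  have fix_nonneg: "0 \<le> x $ k" if "\<forall>i. x $ i = ?R i x" for x k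
    by (rule weighted_mean_fixpoint_nonneg[OF assms(1,4) d c]) (rule that[rule_format, unfolded R])
  \<comment> \<open>Through this equivalence, unique existence of an equilibrium becomes
    \<open>ex1\<close>.\<close>
  have nash: "nash_equilibrium ?u x \<longleftrightarrow> (\<forall>i. x $ i = ?R i x)" for x
  proof
    assume "nash_equilibrium ?u x"
    then have "0 \<le> x $ i" "is_best_response ?u i x (x $ i)" for i
      by (simp add: nash_equilibrium_def, simp add: nash_equilibrium_iff_best_response)
    then show "\<forall>i. x $ i = ?R i x" using best by simp
  next
    assume eqs: "\<forall>i. x $ i = ?R i x"
    then have "is_best_response ?u i x (x $ i)" for i
      using best[of i x "x $ i"] fix_nonneg[OF eqs] eqs[rule_format, of i] by blast
    then show "nash_equilibrium ?u x" by (simp add: nash_equilibrium_iff_best_response)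
  qed
  show ?thesis using best ex1 unfolding nash by blast
qed

end
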